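(* For every $n\ge4$, consider the instance (of the problem and algorithms in the context) with $w_i=1$ for $i=1,\ldots,n$ and $D=1$, defined as follows. Let $$C_1=1,\qquad C_k=1+\sum_{\ell=2}^{k}\ell!,\quad k=2,\ldots,n-1,$$ $$b_1=-C_{n-1},\qquad b_2=1,\qquad b_i=-C_{i-2},\quad i=3,\ldots,n,$$ and set $c=\sum_{i=1}^n b_i-1$. Scan the elements in the order $b_1,b_2,\ldots,b_n$. Then DTA runs in $\Theta(n)$ time, whereas NDTA runs in $\Theta(n^2)$ time.
   Context: The problem is (P): minimize $\sum_{i=1}^n w_ix_i^2$ subject to $\sum_{i=1}^n w_ix_i=c$, $x\le b$, with $w\in\mathbb R^n_{++}$ (strictly positive entries), $b\in\mathbb R^n$, $c<\sum_i w_ib_i$. **Dynamic-Threshold Algorithm (DTA).** Assignments are executed sequentially. Step 1. Set $\mathcal J=\emptyset$, $\mathcal S=\{1\}$, $D=\sum_{i=1}^n w_i b_i-c$, $W=w_1$, $\tau=(w_1b_1-D)/W$. Step 2. For $i=2,\ldots,n$: if $b_i>\tau$, set $W\leftarrow W+w_i$ and then $\tau\leftarrow\tau+w_i(b_i-\tau)/W$. Then, with $\rho_i=b_i-D/w_i$: if $\tau>\rho_i$, set $\mathcal S\leftarrow\mathcal S\cup\{i\}$; otherwise (reset) set $\mathcal J\leftarrow\mathcal J\cup\mathcal S$, $\mathcal S\leftarrow\{i\}$, $W\leftarrow w_i$, $\tau\leftarrow\rho_i$. (If $b_i\le\tau$, index $i$ is skipped.) Step 3. If $\mathcal J\ne\emptyset$,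 for every $j\in\mathcal J$: if $b_j>\tau$, set $\mathcal S\leftarrow\mathcal S\cup\{j\}$, $W\leftarrow W+w_j$, and then $\tau\leftarrow\tau+w_j(b_j-\tau)/W$. Step 4 (removal). Repeat the following pass until a pass leaves $|\mathcal S|$ unchanged: visit every element $i\in\mathcal S$ once; whenever the visited $i$ satisfies $b_i\le\tau$ (with the current $\tau$), set $\mathcal S\leftarrow\mathcal S\setminus\{i\}$, $W\leftarrow W-w_i$, and then $\tau\leftarrow\tau+w_i(\tau-b_i)/W$. Step 5. Return $x^*$ with $x_i^*=\tau$ for $i\in\mathcal S$ and $x_i^*=b_i$ for $i\notin\mathcal S$. **No-Reset Dynamic-Threshold Algorithm (NDTA).** Assignments are executed sequentially; there is no set $\mathcal J$ and there are no resets. Step 1. Set $\mathcal S=\{1\}$, $D=\sum_{i=1}^n w_i b_i-c$, $W=w_1$, $\tau=(w_1b_1-D)/W$. Step 2. For $i=2,\ldots,n$: if $b_i>\tau$, set $\mathcal S\leftarrow\mathcal S\cup\{i\}$, $W\leftarrow W+w_i$, and then $\tau\leftarrow\tau+w_i(b_i-\tau)/W$. (If $b_i\le\tau$, index $i$ is skipped.) Step 3 (removal). Repeat the following pass until a pass leaves $|\mathcal S|$ unchanged: visit every element $i\in\mathcal S$ once; whenever the visited $i$ satisfies $b_i\le\tau$ (with the current $\tau$), set $\mathcal S\leftarrow\mathcal S\setminus\{i\}$, $W\leftarrow W-w_i$, and then $\tau\leftarrow\tau+w_i(\tau-b_i)/W$. Step 4. Return $x^*$ with $x_i^*=\tau$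 for $i\in\mathcal S$ and $x_i^*=b_i$ for $i\notin\mathcal S$. Conventions: $\mathcal S$ is kept as a list in order of insertion, and each removal pass visits the elements of $\mathcal S$ in that order. Time is the number of elementary operations (each comparison, arithmetic operation on reals, and insertion, deletion or visit of one list element has unit cost), so that, up to constant factors, it is the total number of element examinations over all steps. *)

theory Defs
  imports Complex_Main "HOL-Library.Landau_Symbols" "HOL-Library.Monad_Syntax"
begin

section \<open>Counting elementary operations\<close>

text \<open>
  A timed computation is a result paired with the number of elementary operations spent on it.
  Unit costs are introduced only by the primitives below; \<open>ret\<close> and the assignment of local
  variables are free.
\<close>

type_synonym 'a timed = "'a \<times> nat"

definition ret :: "'a \<Rightarrow> 'a timed" where
  "ret x = (x, 0)"

definition unit_cost :: "'a \<Rightarrow> 'a timed" where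
  "unit_cost x = (x, 1)"

definition bind_timed :: "'a timed \<Rightarrow> ('a \<Rightarrow> 'b timed) \<Rightarrow> 'b timed" where
  "bind_timed m f = (let r = f (fst m) in (fst r, snd m + snd r))"

adhoc_overloading Monad_Syntax.bind \<rightleftharpoons> bind_timed

lemma bind_timed_cong [fundef_cong]:
  assumes "m = m'" and "f (fst m') = g (fst m')"
  shows "bind_timed m f = bind_timed m' g"
  using assms by (simp add: bind_timed_def)

definition time :: "'a timed \<Rightarrow> nat" where
  "time = snd"

definition add_op :: "real \<Rightarrow> real \<Rightarrow> real timed" (infixl "+!" 65) where
  "x +! y = unit_cost (x + y)"

definition sub_op :: "real \<Rightarrow> real \<Rightarrow> real timed" (infixl "-!" 65) where
  "x -! y = unit_cost (x - y)"

definition mult_op :: "real \<Rightarrow> real \<Rightarrow> real timed" (infixl "*!" 70) where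
  "x *! y = unit_cost (x * y)"

definition div_op :: "real \<Rightarrow> real \<Rightarrow> real timed" (infixl "'/!" 70) where
  "x /! y = unit_cost (x / y)"

definition less_op :: "real \<Rightarrow> real \<Rightarrow> bool timed" (infix "<!" 50) where
  "x <! y = unit_cost (x < y)"

definition le_op :: "real \<Rightarrow> real \<Rightarrow> bool timed" (infix "\<le>!" 50) where
  "x \<le>! y = unit_cost (x \<le> y)"

definition eq_op :: "nat \<Rightarrow> nat \<Rightarrow> bool timed" (infix "=!" 50) where
  "m =! k = unit_cost (m = k)"

text \<open>Sets of indices are lists without repetition, in order of insertion.\<close>

definition insert_op :: "nat \<Rightarrow> nat list \<Rightarrow> nat list timed" where
  "insert_op i S = unit_cost (S @ [i])"

definition delete_op :: "nat \<Rightarrow> nat list \<Rightarrow> nat list timed" where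
  "delete_op i S = unit_cost (remove1 i S)"

definition visit_op :: "nat \<Rightarrow> nat timed" where
  "visit_op i = unit_cost i"

fun for_each :: "nat list \<Rightarrow> (nat \<Rightarrow> 's \<Rightarrow> 's timed) \<Rightarrow> 's \<Rightarrow> 's timed" where
  "for_each [] body s = ret s"
| "for_each (x # xs) body s = do {
     i \<leftarrow> visit_op x;
     s' \<leftarrow> body i s;
     for_each xs body s'
   }"


section \<open>Building blocks shared by both algorithms\<close>

text \<open>
  The state of both algorithms contains the triple \<open>(S, W, \<tau>)\<close>. Inputs are weights \<open>w\<close> and bounds
  \<open>b\<close>, of which only the entries at the indices \<open>1, \<dots>, n\<close> are used.
\<close>

type_synonym state = "nat list \<times> real \<times> real"

definition slack :: "nat \<Rightarrow> (nat \<Rightarrow> real) \<Rightarrow> (nat \<Rightarrow> real) \<Rightarrow> real \<Rightarrow> real timed" where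
  "slack n w b c = do {
     s \<leftarrow> for_each [1..<n+1] (\<lambda>i s. do { p \<leftarrow> w i *! b i; s +! p }) 0;
     s -! c
   }"

definition initial :: "(nat \<Rightarrow> real) \<Rightarrow> (nat \<Rightarrow> real) \<Rightarrow> real \<Rightarrow> state timed" where
  "initial w b D = do {
     S \<leftarrow> insert_op 1 [];
     p \<leftarrow> w 1 *! b 1;
     d \<leftarrow> p -! D;
     \<tau> \<leftarrow> d /! w 1;
     ret (S, w 1, \<tau>)
   }"

text \<open>\<open>W \<leftarrow> W + w\<^sub>i\<close>, and then \<open>\<tau> \<leftarrow> \<tau> + w\<^sub>i (b\<^sub>i - \<tau>) / W\<close> with the new \<open>W\<close>.\<close>

definition raise_threshold ::
  "(nat \<Rightarrow> real) \<Rightarrow> (nat \<Rightarrow> real) \<Rightarrow> nat \<Rightarrow> real \<Rightarrow> real \<Rightarrow> (real \<times> real) timed" where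
  "raise_threshold w b i W \<tau> = do {
     W' \<leftarrow> W +! w i;
     d \<leftarrow> b i -! \<tau>;
     p \<leftarrow> w i *! d;
     q \<leftarrow> p /! W';
     \<tau>' \<leftarrow> \<tau> +! q;
     ret (W', \<tau>')
   }"

definition add_step :: "(nat \<Rightarrow> real) \<Rightarrow> (nat \<Rightarrow> real) \<Rightarrow> nat \<Rightarrow> state \<Rightarrow> state timed" where
  "add_step w b i = (\<lambda>(S, W, \<tau>). do {
     active \<leftarrow> \<tau> <! b i;
     if active then do {
       S' \<leftarrow> insert_op i S;
       (W', \<tau>') \<leftarrow> raise_threshold w b i W \<tau>;
       ret (S', W', \<tau>')
     } else ret (S, W, \<tau>)
   })"

definition removal_step :: "(nat \<Rightarrow> real) \<Rightarrow> (nat \<Rightarrow> real) \<Rightarrow> nat \<Rightarrow> state \<Rightarrow> state timed" where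
  "removal_step w b i = (\<lambda>(S, W, \<tau>). do {
     inactive \<leftarrow> b i \<le>! \<tau>;
     if inactive then do {
       S' \<leftarrow> delete_op i S;
       W' \<leftarrow> W -! w i;
       d \<leftarrow> \<tau> -! b i;
       p \<leftarrow> w i *! d;
       q \<leftarrow> p /! W';
       \<tau>' \<leftarrow> \<tau> +! q;
       ret (S', W', \<tau>')
     } else ret (S, W, \<tau>)
   })"

text \<open>
  A pass visits the elements that \<open>S\<close> has at its beginning. An element is only ever deleted during
  its own visit, so this is a traversal of the list from which elements are being deleted.
\<close>

definition removal_pass :: "(nat \<Rightarrow> real) \<Rightarrow> (nat \<Rightarrow> real) \<Rightarrow> state \<Rightarrow> state timed" where
  "removal_pass w b st = for_each (fst st) (removal_step w b) st"

lemma length_removal_step: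
  "length (fst (fst (removal_step w b i st))) \<le> length (fst st)"
  by (cases st) (auto simp: removal_step_def bind_timed_def Let_def ret_def unit_cost_def delete_op_def
      le_op_def length_remove1 split: prod.splits)

lemma length_for_each_removal_step:
  "length (fst (fst (for_each xs (removal_step w b) st))) \<le> length (fst st)"
proof (induction xs arbitrary: st)
  case Nil
  then show ?case by (simp add: ret_def)
next
  case (Cons x xs)
  show ?case
    using Cons[of "fst (removal_step w b x st)"] length_removal_step[of w b x st]
    by (simp add: bind_timed_def Let_def visit_op_def unit_cost_def)
qed

lemma length_removal_pass:
  "length (fst (fst (removal_pass w b st))) \<le> length (fst st)"
  unfolding removal_pass_def by (rule length_for_each_removal_step)

text \<open>The cardinality of \<open>S\<close> is stored with the list, so comparing two cardinalities costs one unit.\<close>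

function removal :: "(nat \<Rightarrow> real) \<Rightarrow> (nat \<Rightarrow> real) \<Rightarrow> state \<Rightarrow> state timed" where
  "removal w b st = do {
     st' \<leftarrow> removal_pass w b st;
     unchanged \<leftarrow> length (fst st') =! length (fst st);
     if unchanged then ret st' else removal w b st'
   }"
  by auto
termination
proof (relation "measure (\<lambda>(w, b, st). length (fst st))", goal_cases)
  case 1
  show ?case by simp
next
  case (2 w b st)
  then show ?case
    using length_removal_pass[of w b st]
    by (auto simp: eq_op_def unit_cost_def)
qed

declare removal.simps [simp del]

definition assemble :: "nat \<Rightarrow> (nat \<Rightarrow> real) \<Rightarrow> state \<Rightarrow> (nat \<Rightarrow> real) timed" where
  "assemble n b = (\<lambda>(S, W, \<tau>). do {
     x \<leftarrow> for_each [1..<n+1] (\<lambda>i x. ret (x(i := b i))) (\<lambda>_. 0);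
     for_each S (\<lambda>i x. ret (x(i := \<tau>))) x
   })"


section \<open>The Dynamic-Threshold Algorithm\<close>

text \<open>
  The first component of the state is the set \<open>J\<close>. On a reset the elements of \<open>S\<close> are moved to \<open>J\<close>
  one at a time.
\<close>

definition DTA_scan_step ::
  "(nat \<Rightarrow> real) \<Rightarrow> (nat \<Rightarrow> real) \<Rightarrow> real \<Rightarrow> nat \<Rightarrow> nat list \<times> state \<Rightarrow> (nat list \<times> state) timed" where
  "DTA_scan_step w b D i = (\<lambda>(J, S, W, \<tau>). do {
     active \<leftarrow> \<tau> <! b i;
     if active then do {
       (W', \<tau>') \<leftarrow> raise_threshold w b i W \<tau>;
       q \<leftarrow> D /! w i;
       \<rho> \<leftarrow> b i -! q;
       keep \<leftarrow> \<rho> <! \<tau>';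
       if keep then do {
         S' \<leftarrow> insert_op i S;
         ret (J, S', W', \<tau>')
       } else do {
         J' \<leftarrow> for_each S insert_op J;
         S' \<leftarrow> insert_op i [];
         ret (J', S', w i, \<rho>)
       }
     } else ret (J, S, W, \<tau>)
   })"

definition DTA ::
  "nat \<Rightarrow> (nat \<Rightarrow> real) \<Rightarrow> (nat \<Rightarrow> real) \<Rightarrow> real \<Rightarrow> (nat \<Rightarrow> real) timed" where
  "DTA n w b c = do {
     D \<leftarrow> slack n w b c;
     st1 \<leftarrow> initial w b D;
     (J, st2) \<leftarrow> for_each [2..<n+1] (DTA_scan_step w b D) ([], st1);
     no_reset \<leftarrow> length J =! 0;
     st3 \<leftarrow> (if no_reset then ret st2 else for_each J (add_step w b) st2);
     st4 \<leftarrow> removal w b st3;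
     assemble n b st4
   }"


section \<open>The No-Reset Dynamic-Threshold Algorithm\<close>

definition NDTA ::
  "nat \<Rightarrow> (nat \<Rightarrow> real) \<Rightarrow> (nat \<Rightarrow> real) \<Rightarrow> real \<Rightarrow> (nat \<Rightarrow> real) timed" where
  "NDTA n w b c = do {
     D \<leftarrow> slack n w b c;
     st1 \<leftarrow> initial w b D;
     st2 \<leftarrow> for_each [2..<n+1] (add_step w b) st1;
     st3 \<leftarrow> removal w b st2;
     assemble n b st3
   }"


section \<open>The instance\<close>

text \<open>
  For \<open>k = 1\<close> the sum is empty, so \<open>C\<^sub>1 = 1\<close>. The instance is meant for \<open>n \<ge> 4\<close>; Landau symbols with
  respect to \<open>principal {4..}\<close> bound functions with the same constants for all those \<open>n\<close>.
\<close>

definition inst_C :: "nat \<Rightarrow> real" where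
  "inst_C k = 1 + (\<Sum>l=2..k. fact l)"

definition inst_w :: "nat \<Rightarrow> real" where
  "inst_w i = 1"

definition inst_b :: "nat \<Rightarrow> nat \<Rightarrow> real" where
  "inst_b n i = (if i = 1 then - inst_C (n - 1) else if i = 2 then 1 else - inst_C (i - 2))"

definition inst_c :: "nat \<Rightarrow> real" where
  "inst_c n = (\<Sum>i=1..n. inst_b n i) - 1"

lemma inst_slack: "(\<Sum>i=1..n. inst_w i * inst_b n i) - inst_c n = 1"
  by (simp add: inst_w_def inst_c_def)

end

theory Submission
  imports Defs
begin

text \<open>
  Everything rests on the identity \<open>(k + 1) C\<^sub>k + 1 = C\<^bsub>k+1\<^esub> + (C\<^sub>1 + \<dots> + C\<^bsub>k-1\<^esub>)\<close>. It says that
  during the scan of NDTA every \<open>b\<^sub>i\<close> lies above the current threshold, so that all \<open>n\<close> indices enter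
  \<open>S\<close>; and that once index \<open>1\<close> has been removed, in \<open>S = {2, \<dots>, m}\<close> only the last index \<open>m\<close> lies
  below the threshold. The list being visited in increasing order, each pass then removes a
  single element at its very end, and about \<open>n\<close> passes of linear length are needed. DTA is reset
  at \<open>i = 2\<close> to the threshold \<open>0\<close>, which discards all later indices at unit cost.
\<close>

section \<open>Results and costs of the building blocks, for arbitrary inputs\<close>

lemma fst_bind_timed [simp]: "fst (bind_timed m f) = fst (f (fst m))"
  by (simp add: bind_timed_def Let_def)

lemma snd_bind_timed [simp]: "snd (bind_timed m f) = snd m + snd (f (fst m))"
  by (simp add: bind_timed_def Let_def)

lemmas op_defs = ret_def unit_cost_def add_op_def sub_op_def mult_op_def div_op_def less_op_def
  le_op_def eq_op_def insert_op_def delete_op_def visit_op_def raise_threshold_def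

lemma fst_for_each: "fst (for_each xs body s) = fold (\<lambda>i s. fst (body i s)) xs s"
  by (induction xs arbitrary: s) (simp_all add: op_defs)

lemma length_le_time_for_each: "length xs \<le> snd (for_each xs body s)"
proof (induction xs arbitrary: s)
  case (Cons x xs)
  show ?case using Cons[of "fst (body x s)"] by (simp add: op_defs)
qed simp

lemma time_for_each_le:
  assumes "\<And>i s. snd (body i s) \<le> K"
  shows "snd (for_each xs body s) \<le> length xs * (K + 1)"
proof (induction xs arbitrary: s)
  case (Cons x xs)
  show ?case using Cons[of "fst (body x s)"] assms[of x s] by (simp add: op_defs)
qed (simp add: op_defs)

lemma fst_slack: "fst (slack n w b c) = (\<Sum>i=1..n. w i * b i) - c"
proof -
  have "fold (\<lambda>i s. s + w i * b i) [1..<n+1] (0::real) = (\<Sum>i=1..n. w i * b i)"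
    by (induction n) simp_all
  then show ?thesis by (simp add: slack_def op_defs fst_for_each del: upt_Suc)
qed

lemma time_slack_le: "snd (slack n w b c) \<le> 3 * n + 1"
proof -
  have "snd (for_each [1..<n+1] (\<lambda>i s. bind_timed (w i *! b i) (\<lambda>p. s +! p)) 0)
          \<le> length [1..<n+1] * (2 + 1)"
    by (rule time_for_each_le) (simp add: op_defs)
  then show ?thesis by (simp add: slack_def op_defs del: upt_Suc)
qed

lemma le_time_slack: "n \<le> snd (slack n w b c)"
  using length_le_time_for_each[of "[1..<n+1]" "\<lambda>i s. bind_timed (w i *! b i) (\<lambda>p. s +! p)" 0]
  by (simp add: slack_def del: upt_Suc)

lemma time_initial: "snd (initial w b D) = 4"
  by (simp add: initial_def op_defs)

lemma time_add_step_le: "snd (add_step w b i st) \<le> 7"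
  by (cases st) (simp add: add_step_def op_defs)

lemma time_removal_step_le: "snd (removal_step w b i st) \<le> 7"
  by (cases st) (simp add: removal_step_def op_defs)

lemma time_removal_pass_le: "snd (removal_pass w b st) \<le> 8 * length (fst st)"
  using time_for_each_le[of "removal_step w b" 7 "fst st" st] time_removal_step_le[of w b]
  by (simp add: removal_pass_def)

lemma fst_removal:
  "fst (removal w b st) =
     (let st' = fst (removal_pass w b st)
      in if length (fst st') = length (fst st) then st' else fst (removal w b st'))"
  by (subst removal.simps) (simp add: op_defs Let_def)

lemma time_removal:
  "snd (removal w b st) =
     (let st' = fst (removal_pass w b st)
      in snd (removal_pass w b st) + 1 +
         (if length (fst st') = length (fst st) then 0 else snd (removal w b st')))"
  by (subst removal.simps) (simp add: op_defs Let_def)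

text \<open>Every pass except the last shortens \<open>S\<close>, so there are at most
  \<open>length (fst st) + 1\<close> passes, each costing at most
  \<open>8 * length (fst st) + 1\<close> with its cardinality test. The bound on the final length
  serves to estimate \<open>assemble\<close>.\<close>

lemma removal_bounds:
  "length (fst (fst (removal w b st))) \<le> length (fst st) \<and>
   snd (removal w b st) \<le> (length (fst st) + 1) * (8 * length (fst st) + 1)"
proof (induction "length (fst st)" arbitrary: st rule: less_induct)
  case less
  define st' where "st' = fst (removal_pass w b st)"
  define L where "L = length (fst st)"
  have pass: "snd (removal_pass w b st) \<le> 8 * L"
    unfolding L_def by (rule time_removal_pass_le)
  show ?case
  proof (cases "length (fst st') = length (fst st)")
    case True
    then show ?thesis using pass
      unfolding fst_removal[of w b st] time_removal[of w b st] Let_def st'_def[symmetric] L_def[symmetric]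
      by simp
  next
    case False
    then have lt: "length (fst st') < L"
      using length_removal_pass[of w b st] by (simp add: st'_def L_def)
    then obtain m where m: "L = Suc m" "length (fst st') \<le> m"
      by (metis less_Suc_eq_le less_imp_Suc_add add.commute le_add2 less_natE)
    have IH: "length (fst (fst (removal w b st'))) \<le> length (fst st')"
      "snd (removal w b st') \<le> (length (fst st') + 1) * (8 * length (fst st') + 1)"
      using less[of st'] lt by (simp_all add: L_def)
    have "(length (fst st') + 1) * (8 * length (fst st') + 1) \<le> (m + 1) * (8 * m + 1)"
      using m by (intro mult_le_mono) auto
    then have "snd (removal w b st) \<le> 8 * L + 1 + (m + 1) * (8 * m + 1)"
      using False IH pass
      unfolding time_removal[of w b st] Let_def st'_def[symmetric] L_def[symmetric] by simp
    also have "\<dots> \<le> (L + 1) * (8 * L + 1)"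
      by (simp add: m algebra_simps)
    finally show ?thesis
      using False IH lt
      unfolding fst_removal[of w b st] Let_def st'_def[symmetric] L_def[symmetric] by simp
  qed
qed

lemma time_assemble_le: "snd (assemble n b st) \<le> n + length (fst st)"
proof -
  obtain S W \<tau> where st: "st = (S, W, \<tau>)" by (cases st)
  have "snd (for_each [1..<n+1] (\<lambda>i x. ret (x(i := b i))) (\<lambda>_. 0)) \<le> length [1..<n+1] * (0 + 1)"
    by (rule time_for_each_le) (simp add: op_defs)
  moreover have "snd (for_each S (\<lambda>i x. ret (x(i := \<tau>))) x) \<le> length S * (0 + 1)"
    for x :: "nat \<Rightarrow> real"
    by (rule time_for_each_le) (simp add: op_defs)
  ultimately show ?thesis
    by (simp add: assemble_def st add_mono del: upt_Suc)
qed

section \<open>The numbers \<open>inst_C k\<close> and their partial sums\<close>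

lemma inst_C_Suc: "k \<ge> 1 \<Longrightarrow> inst_C (Suc k) = inst_C k + fact (Suc k)"
  by (simp add: inst_C_def)

lemma inst_C_ge_1: "inst_C k \<ge> 1"
  by (simp add: inst_C_def sum_nonneg)

lemma inst_C_mono: "k \<le> l \<Longrightarrow> inst_C k \<le> inst_C l"
  by (auto simp: inst_C_def intro!: sum_mono2)

definition sum_C :: "nat \<Rightarrow> real" where
  "sum_C k = (\<Sum>l=1..k. inst_C l)"

lemma sum_C_Suc: "sum_C (Suc k) = sum_C k + inst_C (Suc k)"
  by (simp add: sum_C_def)

lemma sum_C_0: "sum_C 0 = 0"
  by (simp add: sum_C_def)

lemma sum_C_nonneg: "sum_C k \<ge> 0"
  unfolding sum_C_def by (intro sum_nonneg order_trans[OF zero_le_one inst_C_ge_1])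

lemma sum_C_le: "sum_C k \<le> real k * inst_C k"
proof -
  have "sum_C k \<le> (\<Sum>l=1..k. inst_C k)"
    unfolding sum_C_def by (rule sum_mono) (simp add: inst_C_mono)
  then show ?thesis by simp
qed

text \<open>The increments of \<open>inst_C\<close> are factorials, so each is the previous one
  times the next integer; the induction step uses nothing else. The index is shifted so that the
  base case has an empty partial sum.\<close>

lemma inst_C_identity:
  "(real k + 2) * inst_C (Suc k) + 1 = inst_C (Suc (Suc k)) + sum_C k"
proof (induction k)
  case 0
  have "inst_C (Suc 0) = 1" by (simp add: inst_C_def)
  moreover have "inst_C (Suc (Suc 0)) = 3" using inst_C_Suc[of "Suc 0"] calculation by simp
  ultimately show ?case by (simp add: sum_C_0)
next
  case (Suc k)
  have "inst_C (Suc (Suc (Suc k))) - inst_C (Suc (Suc k))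
          = (real k + 3) * (inst_C (Suc (Suc k)) - inst_C (Suc k))"
    using inst_C_Suc[of "Suc (Suc k)"] inst_C_Suc[of "Suc k"] fact_Suc[of "Suc (Suc k)", where ?'a = real]
    by (simp del: fact_Suc)
  then show ?case using Suc by (simp add: sum_C_Suc algebra_simps)
qed

section \<open>The run of NDTA on the instance: scan, then removal\<close>

lemma inst_b_simps:
  "inst_b n (Suc 0) = - inst_C (n - 1)" "inst_b n 2 = 1" "inst_b n (k + 3) = - inst_C (Suc k)"
  by (simp_all add: inst_b_def numeral_3_eq_3)

lemma fst_slack_inst: "fst (slack n inst_w (inst_b n) (inst_c n)) = 1"
  by (simp only: fst_slack inst_slack)

text \<open>The state of NDTA once the indices up to \<open>j + 2\<close> have all been inserted.
  With unit weights the threshold is the sum of the bounds in \<open>S\<close> minus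
  \<open>D\<close>, divided by the size of \<open>S\<close>; the bound 1 of index 2 cancels
  \<open>D = 1\<close>.\<close>

definition scan_state :: "nat \<Rightarrow> nat \<Rightarrow> state" where
  "scan_state n j = ([1..<j+3], real j + 2, - (inst_C (n - 1) + sum_C j) / (real j + 2))"

text \<open>The analogous state for the indices from 2 to \<open>k + 2\<close>, with index 1
  removed.\<close>

definition tail_state :: "nat \<Rightarrow> state" where
  "tail_state k = ([2..<k+3], real k + 1, - sum_C k / (real k + 1))"

lemma upt_add_4: "i \<le> k + 3 \<Longrightarrow> [i..<k+4] = [i..<k+3] @ [k+3]"
  by (simp add: eval_nat_numeral)

text \<open>The incremental update keeps the threshold in closed form: a bound \<open>- c\<close>
  joins \<open>x\<close> elements of unit weight.\<close>

lemma threshold_add: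
  fixes x A c :: real
  assumes "x > 0"
  shows "- A / x + (- c - - A / x) / (x + 1) = - (A + c) / (x + 1)"
  using assms by (simp add: divide_simps) (simp add: algebra_simps)

lemma threshold_remove:
  fixes x A c :: real
  assumes "x > 0"
  shows "- (c + A) / (x + 1) + (- (c + A) / (x + 1) + c) / x = - A / x"
  using assms by (simp add: divide_simps) (simp add: algebra_simps)

lemma add_step_scan_state:
  assumes "j + 3 \<le> n"
  shows "fst (add_step inst_w (inst_b n) (j + 3) (scan_state n j)) = scan_state n (Suc j)"
proof -
  \<comment> \<open>The large first bound replaces \<open>inst_C (j + 2)\<close> in the identity,
    whose summand 1 makes the comparison strict.\<close>
  have "inst_C (Suc (Suc j)) \<le> inst_C (n - 1)"
    by (rule inst_C_mono) (use assms in simp)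
  then have "(real j + 2) * inst_C (Suc j) < inst_C (n - 1) + sum_C j"
    using inst_C_identity[of j] by linarith
  then have "- (inst_C (n - 1) + sum_C j) / (real j + 2) < - inst_C (Suc j)"
    by (simp add: field_simps)
  then show ?thesis
    unfolding add_step_def scan_state_def
    using threshold_add[of "real j + 2" "inst_C (n - 1) + sum_C j" "inst_C (Suc j)"]
    by (simp add: op_defs inst_b_simps inst_w_def sum_C_Suc) (simp add: algebra_simps upt_add_4)
qed

lemma add_step_initial:
  "fst (add_step inst_w (inst_b n) 2 (fst (initial inst_w (inst_b n) 1))) = scan_state n 0"
  using inst_C_ge_1[of "n - 1"]
  by (simp add: initial_def add_step_def scan_state_def op_defs inst_b_simps inst_w_def sum_C_0
      upt_conv_Cons)
    (simp add: field_simps)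

lemma NDTA_scan_result:
  assumes "j + 2 \<le> n"
  shows "fst (for_each [2..<j+3] (add_step inst_w (inst_b n)) (fst (initial inst_w (inst_b n) 1)))
           = scan_state n j"
  using assms
proof (induction j)
  case 0
  have "[2..<0+3] = [2::nat]" by (simp add: upt_conv_Cons)
  then show ?case using add_step_initial by (simp add: fst_for_each del: for_each.simps)
next
  case (Suc j)
  then show ?case using add_step_scan_state[of j n]
    by (simp add: fst_for_each upt_add_4 add.commute[of 4] del: upt_Suc)
qed

text \<open>No value of \<open>inst_C\<close> occurring in the numerator exceeds
  \<open>inst_C (n - 1)\<close>, so the bound of index 1 is at most the threshold.\<close>

lemma removal_step_scan_state:
  assumes "n = k + 2"
  shows "fst (removal_step inst_w (inst_b n) 1 (scan_state n k)) = tail_state k"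
proof -
  have "inst_C k \<le> inst_C (n - 1)" by (rule inst_C_mono) (use assms in simp)
  then have "sum_C k \<le> real k * inst_C (n - 1)"
    using sum_C_le[of k] by (smt (verit) mult_left_mono of_nat_0_le_iff)
  then have "- inst_C (n - 1) \<le> - (inst_C (n - 1) + sum_C k) / (real k + 2)"
    using inst_C_ge_1[of "n - 1"] by (simp add: field_simps)
  moreover have "[1..<k+3] = 1 # [2..<k+3]"
    by (simp add: upt_conv_Cons eval_nat_numeral del: upt_Suc)
  ultimately show ?thesis
    using threshold_remove[of "real k + 1" "inst_C (n - 1)" "sum_C k"]
    unfolding removal_step_def scan_state_def tail_state_def
    by (simp add: op_defs inst_b_simps inst_w_def add.commute)
qed

lemma removal_step_tail_state_keep:
  assumes "2 \<le> i" "i < k + 2"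
  shows "fst (removal_step inst_w (inst_b n) i (tail_state k)) = tail_state k"
proof (cases "i = 2")
  case True
  have "- sum_C k / (real k + 1) \<le> 0"
    using sum_C_nonneg by (simp add: field_simps)
  then have "- sum_C k / (real k + 1) < 1" by linarith
  then show ?thesis
    unfolding removal_step_def tail_state_def True by (simp add: op_defs inst_b_simps)
next
  case False
  define j where "j = i - 3"
  have i: "i = j + 3" using False assms by (simp add: j_def)
  define m where "m = k - 2"
  have k: "k = Suc (Suc m)" using i assms by (simp add: m_def)
  have "inst_C (Suc j) \<le> inst_C (Suc m)"
    by (rule inst_C_mono) (use i k assms in simp)
  then have "(real m + 3) * inst_C (Suc j) \<le> (real m + 3) * inst_C (Suc m)"
    by (intro mult_left_mono) auto
  \<comment> \<open>Adding \<open>inst_C (m + 1)\<close> to both sides of the identity completes the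
    partial sum: the left-hand side here equals \<open>sum_C k - 1\<close>.\<close>
  also have "\<dots> < sum_C k"
    using inst_C_identity[of m] by (simp add: k sum_C_Suc algebra_simps)
  finally have "- sum_C k / (real k + 1) < - inst_C (Suc j)"
    by (simp add: k field_simps)
  then show ?thesis
    unfolding removal_step_def tail_state_def i by (simp add: op_defs inst_b_simps)
qed

text \<open>The last index carries the largest of the values summed in \<open>sum_C (Suc k)\<close>,
  so its bound is at most the threshold.\<close>

lemma removal_step_tail_state_last:
  "fst (removal_step inst_w (inst_b n) (k + 3) (tail_state (Suc k))) = tail_state k"
proof -
  have "sum_C (Suc k) \<le> (real k + 2) * inst_C (Suc k)"
    using sum_C_le[of "Suc k"] inst_C_ge_1[of "Suc k"] by (simp add: algebra_simps)
  then have "- inst_C (Suc k) \<le> - sum_C (Suc k) / (real k + 2)"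
    by (simp add: field_simps)
  moreover have "remove1 (k + 3) [2..<Suc k + 3] = [2..<k+3]"
  proof -
    have "[2..<Suc k + 3] = [2..<k+3] @ [k+3]" using upt_add_4[of 2 k] by (simp add: add.commute)
    then show ?thesis by (simp add: remove1_append del: upt_Suc)
  qed
  ultimately show ?thesis
    using threshold_remove[of "real k + 1" "inst_C (Suc k)" "sum_C k"]
    unfolding removal_step_def tail_state_def
    by (simp add: op_defs inst_b_simps inst_w_def sum_C_Suc add.commute del: upt_Suc)
qed

text \<open>Deleting \<open>k + 3\<close> raises the threshold; for \<open>k \<ge> 1\<close> index
  \<open>k + 2\<close> now has to leave as well, but its visit in this pass is already over. This
  delay forces one pass per element.\<close>

lemma for_each_removal_step_tail_state:
  "fst (for_each [2..<k+4] (removal_step inst_w (inst_b n)) (tail_state (Suc k))) = tail_state k"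
proof -
  have "fold (\<lambda>i s. fst (removal_step inst_w (inst_b n) i s)) [2..<j+2] (tail_state (Suc k))
          = tail_state (Suc k)" if "j \<le> Suc k" for j
    using that
  proof (induction j)
    case (Suc j)
    then show ?case using removal_step_tail_state_keep[of "j + 2" "Suc k" n] by simp
  qed simp
  from this[of "Suc k"] have
    "fold (\<lambda>i s. fst (removal_step inst_w (inst_b n) i s)) [2..<k+3] (tail_state (Suc k))
       = tail_state (Suc k)" by (simp add: numeral_3_eq_3)
  moreover have "[2..<k+4] = [2..<k+3] @ [k+3]" by (simp add: eval_nat_numeral)
  ultimately show ?thesis
    using removal_step_tail_state_last[of n k] by (simp add: fst_for_each)
qed

lemma removal_pass_tail_state:
  "fst (removal_pass inst_w (inst_b n) (tail_state (Suc k))) = tail_state k"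
proof -
  have "fst (tail_state (Suc k)) = [2..<k+4]" by (simp add: tail_state_def eval_nat_numeral)
  then show ?thesis
    unfolding removal_pass_def by (simp only: for_each_removal_step_tail_state)
qed

lemma length_tail_state: "length (fst (tail_state k)) = k + 1"
  by (simp add: tail_state_def del: upt_Suc)

text \<open>The visits alone suffice: successive passes have lengths \<open>k + 1\<close>,
  \<open>k\<close>, and so on, an arithmetic series.\<close>

lemma time_removal_tail_state_ge:
  "k * (k + 1) \<le> 2 * snd (removal inst_w (inst_b n) (tail_state k))"
proof (induction k)
  case (Suc k)
  have "k + 2 \<le> snd (removal_pass inst_w (inst_b n) (tail_state (Suc k)))"
    using length_le_time_for_each[of "fst (tail_state (Suc k))"]
    by (simp add: removal_pass_def length_tail_state)
  then show ?case using Suc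
    by (simp add: time_removal[of _ _ "tail_state (Suc k)"] removal_pass_tail_state length_tail_state)
qed simp

lemma time_removal_scan_state_ge:
  assumes "n = k + 3"
  shows "k * (k + 1) \<le> 2 * snd (removal inst_w (inst_b n) (scan_state n (Suc k)))"
proof -
  have n: "n = Suc k + 2" using assms by simp
  have S: "fst (scan_state n (Suc k)) = 1 # [2..<k+4]"
    by (simp add: scan_state_def upt_conv_Cons eval_nat_numeral del: upt_Suc)
  \<comment> \<open>The first pass deletes two elements: index 1 at once, and the last index at the
    end.\<close>
  have "fst (removal_pass inst_w (inst_b n) (scan_state n (Suc k))) = tail_state k"
    using for_each_removal_step_tail_state[of k n] removal_step_scan_state[of n "Suc k", OF n]
    by (simp add: removal_pass_def S fst_for_each visit_op_def unit_cost_def)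
  then show ?thesis
    using time_removal_tail_state_ge[of k n]
    by (simp add: time_removal[of _ _ "scan_state n (Suc k)"] length_tail_state S del: upt_Suc)
qed

lemma NDTA_scan_inst:
  assumes "n \<ge> 4"
  shows "fst (for_each [2..<n+1] (add_step inst_w (inst_b n)) (fst (initial inst_w (inst_b n) 1)))
           = scan_state n (n - 2)"
proof -
  have "n + 1 = n - 2 + 3" using assms by simp
  then show ?thesis using NDTA_scan_result[of "n - 2" n] assms by (simp del: upt_Suc)
qed

section \<open>Total time of NDTA\<close>

lemma time_NDTA_inst:
  assumes "n \<ge> 4"
  shows "time (NDTA n inst_w (inst_b n) (inst_c n)) =
    snd (slack n inst_w (inst_b n) (inst_c n)) + 4 +
    snd (for_each [2..<n+1] (add_step inst_w (inst_b n)) (fst (initial inst_w (inst_b n) 1))) +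
    snd (removal inst_w (inst_b n) (scan_state n (n - 2))) +
    snd (assemble n (inst_b n) (fst (removal inst_w (inst_b n) (scan_state n (n - 2)))))"
  using NDTA_scan_inst[OF assms]
  by (simp add: time_def NDTA_def fst_slack_inst time_initial del: upt_Suc)

lemma time_NDTA_inst_ge:
  assumes "n \<ge> 4"
  shows "n\<^sup>2 \<le> 16 * time (NDTA n inst_w (inst_b n) (inst_c n))"
proof -
  obtain m where m: "n = m + 4" using assms le_iff_add by (metis add.commute)
  \<comment> \<open>Equality holds at \<open>m = 0\<close>, that is \<open>n = 4\<close>; the factor
    2 of the series bound turns 8 into 16.\<close>
  have "n\<^sup>2 \<le> 8 * ((m + 1) * (m + 1 + 1))"
    by (simp add: m power2_eq_square algebra_simps)
  also have "(m + 1) * (m + 1 + 1) \<le> 2 * snd (removal inst_w (inst_b n) (scan_state n (n - 2)))"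
    using time_removal_scan_state_ge[of n "m + 1"] m by simp
  finally show ?thesis
    using time_NDTA_inst[OF assms] by simp
qed

lemma time_NDTA_inst_le:
  assumes "n \<ge> 4"
  shows "time (NDTA n inst_w (inst_b n) (inst_c n)) \<le> 40 * n\<^sup>2"
proof -
  have L: "length (fst (scan_state n (n - 2))) = n"
    unfolding scan_state_def fst_conv length_upt using assms by arith
  have "snd (for_each [2..<n+1] (add_step inst_w (inst_b n)) (fst (initial inst_w (inst_b n) 1)))
          \<le> length [2..<n+1] * (7 + 1)"
    by (rule time_for_each_le) (rule time_add_step_le)
  also have "\<dots> \<le> 8 * n" by (simp del: upt_Suc)
  \<comment> \<open>The summands belong to \<open>slack\<close>, \<open>initial\<close>, the scan,
    \<open>removal\<close> and \<open>assemble\<close>, the last with at most \<open>n\<close>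
    elements left in \<open>S\<close>.\<close>
  finally have "time (NDTA n inst_w (inst_b n) (inst_c n))
      \<le> (3 * n + 1) + 4 + 8 * n + (n + 1) * (8 * n + 1) + 2 * n"
    using time_NDTA_inst[OF assms] time_slack_le[of n inst_w "inst_b n" "inst_c n"]
      removal_bounds[of inst_w "inst_b n" "scan_state n (n - 2)"]
      time_assemble_le[of n "inst_b n" "fst (removal inst_w (inst_b n) (scan_state n (n - 2)))"]
    unfolding L by linarith
  also have "\<dots> = 8 * n\<^sup>2 + 22 * n + 6"
    by (simp add: power2_eq_square algebra_simps)
  also have "\<dots> \<le> 40 * n\<^sup>2"
  proof -
    have "4 * n \<le> n\<^sup>2" using assms by (simp add: power2_eq_square)
    then show ?thesis using assms by linarith
  qed
  finally show ?thesis .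
qed

section \<open>The run of DTA on the instance\<close>

lemma DTA_scan_step_reset:
  "DTA_scan_step inst_w (inst_b n) 1 2 ([], fst (initial inst_w (inst_b n) 1))
     = (([1], [2], 1, 0), 12)"
proof -
  \<comment> \<open>The raised threshold is \<open>- inst_C (n - 1) / 2\<close>, below the value 0
    of \<rho> at index 2. Hence the reset, which moves index 1 to \<open>J\<close>.\<close>
  have "- inst_C (n - 1) - 1 < 1" "\<not> 0 < - inst_C (n - 1) - 1 + (1 - (- inst_C (n - 1) - 1)) / 2"
    using inst_C_ge_1[of "n - 1"] by (simp_all add: field_simps)
  then show ?thesis
    by (intro prod_eqI)
      (simp_all add: DTA_scan_step_def initial_def op_defs inst_b_simps inst_w_def)
qed

text \<open>All bounds from index 3 on are negative, so the threshold 0 rejects them with a single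
  comparison.\<close>

lemma DTA_scan_step_skip:
  assumes "i \<ge> 3"
  shows "DTA_scan_step inst_w (inst_b n) 1 i ([1], [2], 1, 0) = (([1], [2], 1, 0), 1)"
proof -
  have "inst_b n i \<le> 0"
    using inst_b_simps(3)[of n "i - 3"] inst_C_ge_1[of "Suc (i - 3)"] assms by simp
  then show ?thesis
    by (intro prod_eqI) (simp_all add: DTA_scan_step_def op_defs)
qed

lemma DTA_scan_inst:
  assumes "n \<ge> 2"
  shows "for_each [2..<n+1] (DTA_scan_step inst_w (inst_b n) 1) ([], fst (initial inst_w (inst_b n) 1))
           = (([1], [2], 1, 0), 13 + 2 * (n - 2))"
proof -
  have skip: "for_each xs (DTA_scan_step inst_w (inst_b n) 1) ([1], [2], 1, 0)
          = (([1], [2], 1, 0), 2 * length xs)" if "\<forall>i\<in>set xs. i \<ge> 3" for xs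
    using that
  proof (induction xs)
    case (Cons x xs)
    then show ?case using DTA_scan_step_skip[of x n]
      by (intro prod_eqI) (simp_all add: op_defs)
  qed (simp add: op_defs)
  have "[2..<n+1] = 2 # [3..<n+1]" using assms by (simp add: upt_conv_Cons)
  then show ?thesis
    using skip[of "[3..<n+1]"] DTA_scan_step_reset[of n] assms
    by (intro prod_eqI) (simp_all add: op_defs del: upt_Suc)
qed

lemma DTA_removal_inst: "removal inst_w (inst_b n) ([2], 1, 0) = (([2], 1, 0), 3)"
proof -
  have "removal_pass inst_w (inst_b n) ([2], 1, 0) = (([2], 1, 0), 2)"
    by (intro prod_eqI) (simp_all add: removal_pass_def removal_step_def op_defs inst_b_simps)
  then show ?thesis
    by (intro prod_eqI) (simp_all add: fst_removal[of _ _ "([2], 1, 0)"] time_removal[of _ _ "([2], 1, 0)"])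
qed

text \<open>The constant 23 collects 4 for \<open>initial\<close>, 13 for index 2 in the scan, 1 for
  testing \<open>J\<close>, 2 for re-examining index 1, and 3 for the single removal pass with its
  cardinality test.\<close>

lemma time_DTA_inst:
  assumes "n \<ge> 4"
  shows "time (DTA n inst_w (inst_b n) (inst_c n)) =
    snd (slack n inst_w (inst_b n) (inst_c n)) + 23 + 2 * (n - 2)
      + snd (assemble n (inst_b n) ([2], 1, 0))"
proof -
  have "for_each [1] (add_step inst_w (inst_b n)) ([2], 1, 0) = (([2], 1, 0), 2)"
    using inst_C_ge_1[of "n - 1"]
    by (intro prod_eqI) (simp_all add: add_step_def op_defs inst_b_simps)
  then show ?thesis
    using assms DTA_scan_inst[of n]
    by (simp add: time_def DTA_def fst_slack_inst time_initial DTA_removal_inst eq_op_def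
        unit_cost_def del: upt_Suc for_each.simps)
qed

theorem corollary1:
  shows "(\<lambda>n. real (time (DTA n inst_w (inst_b n) (inst_c n))))
           \<in> \<Theta>[principal {4..}](\<lambda>n. real n) \<and>
         (\<lambda>n. real (time (NDTA n inst_w (inst_b n) (inst_c n))))
           \<in> \<Theta>[principal {4..}](\<lambda>n. (real n)\<^sup>2)"
proof (intro conjI bigthetaI)
  show "(\<lambda>n. real (time (DTA n inst_w (inst_b n) (inst_c n)))) \<in> O[principal {4..}](\<lambda>n. real n)"
  \<comment> \<open>The estimates add up to \<open>6 * n + 21\<close>, which is at most
    \<open>13 * n\<close> for \<open>n \<ge> 4\<close>.\<close>
  proof (rule bigoI[of _ 13], unfold eventually_principal, intro ballI)
    fix n :: nat assume "n \<in> {4..}"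
    then have "time (DTA n inst_w (inst_b n) (inst_c n)) \<le> 13 * n"
      using time_DTA_inst[of n] time_slack_le[of n inst_w "inst_b n" "inst_c n"]
        time_assemble_le[of n "inst_b n" "([2], 1, 0)"] by simp
    then show "norm (real (time (DTA n inst_w (inst_b n) (inst_c n)))) \<le> 13 * norm (real n)"
      by simp
  qed
  show "(\<lambda>n. real (time (DTA n inst_w (inst_b n) (inst_c n)))) \<in> \<Omega>[principal {4..}](\<lambda>n. real n)"
  proof (rule landau_omega.bigI[of 1], simp, unfold eventually_principal, intro ballI)
    fix n :: nat assume "n \<in> {4..}"
    \<comment> \<open>Computing \<open>D\<close> already visits all \<open>n\<close>
      indices.\<close>
    then have "n \<le> time (DTA n inst_w (inst_b n) (inst_c n))"
      using time_DTA_inst[of n] le_time_slack[of n inst_w "inst_b n" "inst_c n"] by simp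
    then show "norm (real (time (DTA n inst_w (inst_b n) (inst_c n)))) \<ge> 1 * norm (real n)"
      by simp
  qed
  show "(\<lambda>n. real (time (NDTA n inst_w (inst_b n) (inst_c n)))) \<in> O[principal {4..}](\<lambda>n. (real n)\<^sup>2)"
  proof (rule bigoI[of _ 40], unfold eventually_principal, intro ballI)
    fix n :: nat assume "n \<in> {4..}"
    then have "real (time (NDTA n inst_w (inst_b n) (inst_c n))) \<le> real (40 * n\<^sup>2)"
      using time_NDTA_inst_le[of n] by (intro of_nat_mono) simp
    then show "norm (real (time (NDTA n inst_w (inst_b n) (inst_c n)))) \<le> 40 * norm ((real n)\<^sup>2)"
      by simp
  qed
  show "(\<lambda>n. real (time (NDTA n inst_w (inst_b n) (inst_c n)))) \<in> \<Omega>[principal {4..}](\<lambda>n. (real n)\<^sup>2)"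
  proof (rule landau_omega.bigI[of "1/16"], simp, unfold eventually_principal, intro ballI)
    fix n :: nat assume "n \<in> {4..}"
    then have "real (n\<^sup>2) \<le> real (16 * time (NDTA n inst_w (inst_b n) (inst_c n)))"
      using time_NDTA_inst_ge[of n] by (intro of_nat_mono) simp
    then show "norm (real (time (NDTA n inst_w (inst_b n) (inst_c n)))) \<ge> 1/16 * norm ((real n)\<^sup>2)"
      by simp
  qed
qed

end
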